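(* Let $[(f,g)]_{\approx}\in\mathbb{IE}$, $C'$ a program, $\xi$ a probabilistic guard, $I,G\in\mathbb{E}_{\geq0}^{\infty}$ with $G(\sigma)<\infty$ for all $\sigma\in\Sigma$, and $(H_n)_{n\in\mathbb N}\subseteq\mathbb{E}_{\geq0}^{\infty}$. If $\Phi_{g}(G)\le G$, $\Phi_{|f|+f}(I)\le I$, $H_0\le\Phi_{|f|}(\mathbf 0)$, and $H_{n+1}\le\Phi_{|f|}(H_n)$ for all $n$, then $$\widetilde{\mathsf{wp}}[\mathtt{while}(\xi)\{C'\}]\,[(f,g)]_{\approx}\;\sqsubseteq\;\Big[\big(I-\sup_{n\in\mathbb N}H_n,\;2\cdot G\big)\Big]_{\approx}.$$
   Context: Programs: $C::=\mathtt{skip}\mid x:=E\mid C;C\mid \mathtt{if}(\xi)\{C\}\mathtt{else}\{C\}\mid\mathtt{while}(\xi)\{C\}$ over states $\Sigma$, guards interpreted as $p_\xi:\Sigma\to[0,1]$. $\mathbb{E}_{\geq0}^{\infty}=\{\Sigma\to[0,\infty]\}$, $\mathbb E^\star=\{\Sigma\to\mathbb R\}$, $\mathbf0=\lambda\sigma.0$. The standard transformer $\mathsf{wp}[C]$ on $\mathbb{E}_{\geq0}^{\infty}$: $\mathsf{wp}[\mathtt{skip}](h)=h$, $\mathsf{wp}[x:=E](h)=h[x/E]$, $\mathsf{wp}[C_1;C_2](h)=\mathsf{wp}[C_1](\mathsf{wp}[C_2](h))$, $\mathsf{wp}[\mathtt{if}(\xi)\{C_1\}\mathtt{else}\{C_2\}](h)=p_\xi\cdot\mathsf{wp}[C_1](h)+(1-p_\xi)\cdot\mathsf{wp}[C_2](h)$,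 $\mathsf{wp}[\mathtt{while}(\xi)\{C'\}](h)=\mathrm{lfp}\,\Phi_h$ where $\Phi_h(X)=(1-p_\xi)\cdot h+p_\xi\cdot\mathsf{wp}[C'](X)$ is the characteristic functional. $\mathbb P=\{(f,g)\mid f\in\mathbb E^\star,g\in\mathbb{E}_{\geq0}^{\infty},|f|\le g\}$; $(f,g)\precsim(f',g')$ iff for all $\sigma$, $g'(\sigma)\ne\infty$ implies $f(\sigma)\le f'(\sigma)$ and $g(\sigma)\le g'(\sigma)$; $\approx\,=\,\precsim\cap\succsim$; $[(f,g)]_\approx$ the class, $\mathbb{IE}$ the set of classes, $\sqsubseteq$ the induced partial order. The mixed-sign transformer $\widetilde{\mathsf{wp}}[C]$ on $\mathbb{IE}$ acts componentwise for skip/assignment/sequencing, uses $p_\xi\cdot(\cdot)+(1-p_\xi)\cdot(\cdot)$ with $c\cdot(f,g)=(cf,|c|g)$ for conditionals, and for loops is $\lim_{n\to\omega}\Psi^n([(\mathbf0,\mathbf0)]_\approx)$ with $\Psi([(X,Y)]_\approx)=(1-p_\xi)\cdot[(f,g)]_\approx+p_\xi\cdot\widetilde{\mathsf{wp}}[C'][(X,Y)]_\approx$.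
   Formalization: The pair (I − sup H_n, 2G) need not lie in P (I may be infinite or too large); the formal theorem proves the inequality defining the order for this raw pair, in extended reals, and the inequality of classes whenever the difference is real-valued and the pair is in P. *)

theory Defs
  imports Complex_Main "HOL-Library.Extended_Nonnegative_Real"
begin
typedef prob = "{0..1 :: real}"
  morphisms real_of_prob Abs_prob
  by auto

type_synonym ('v, 'd) state = "'v \<Rightarrow> 'd"

text \<open>Expressions and guards are embedded semantically: a guard is the function
  mapping a state to the probability that the guard evaluates to true there.\<close>

type_synonym ('v, 'd) guard = "('v, 'd) state \<Rightarrow> prob"

datatype ('v, 'd) prog =
    Skip
  | Assign 'v "('v, 'd) state \<Rightarrow> 'd"
  | Seq "('v, 'd) prog" "('v, 'd) prog"
  | If "('v, 'd) guard" "('v, 'd) prog" "('v, 'd) prog"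
  | While "('v, 'd) guard" "('v, 'd) prog"

definition subst :: "(('v, 'd) state \<Rightarrow> 'r) \<Rightarrow> 'v \<Rightarrow> (('v, 'd) state \<Rightarrow> 'd) \<Rightarrow> ('v, 'd) state \<Rightarrow> 'r"
  where "subst h x E = (\<lambda>\<sigma>. h (\<sigma>(x := E \<sigma>)))"

definition mix :: "('s \<Rightarrow> prob) \<Rightarrow> ('s \<Rightarrow> ennreal) \<Rightarrow> ('s \<Rightarrow> ennreal) \<Rightarrow> 's \<Rightarrow> ennreal"
  where "mix p X Y = (\<lambda>\<sigma>. ennreal (real_of_prob (p \<sigma>)) * X \<sigma> + ennreal (1 - real_of_prob (p \<sigma>)) * Y \<sigma>)"

text \<open>The characteristic functional of a loop with guard \<open>p\<close> with respect to \<open>h\<close>,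
  where \<open>T\<close> is the transformer of the loop body.\<close>

definition char_fun ::
  "('s \<Rightarrow> prob) \<Rightarrow> (('s \<Rightarrow> ennreal) \<Rightarrow> 's \<Rightarrow> ennreal) \<Rightarrow> ('s \<Rightarrow> ennreal) \<Rightarrow> ('s \<Rightarrow> ennreal) \<Rightarrow> 's \<Rightarrow> ennreal"
  where "char_fun p T h X =
    (\<lambda>\<sigma>. ennreal (1 - real_of_prob (p \<sigma>)) * h \<sigma> + ennreal (real_of_prob (p \<sigma>)) * T X \<sigma>)"

primrec wp :: "('v, 'd) prog \<Rightarrow> (('v, 'd) state \<Rightarrow> ennreal) \<Rightarrow> ('v, 'd) state \<Rightarrow> ennreal" where
  "wp Skip h = h"
| "wp (Assign x E) h = subst h x E"
| "wp (Seq C1 C2) h = wp C1 (wp C2 h)"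
| "wp (If p C1 C2) h = mix p (wp C1 h) (wp C2 h)"
| "wp (While p C) h = lfp (char_fun p (wp C) h)"

definition witness_pairs :: "(('s \<Rightarrow> real) \<times> ('s \<Rightarrow> ennreal)) set"
  where "witness_pairs = {(f, g). \<forall>\<sigma>. ennreal \<bar>f \<sigma>\<bar> \<le> g \<sigma>}"

definition pair_le ::
  "('s \<Rightarrow> real) \<times> ('s \<Rightarrow> ennreal) \<Rightarrow> ('s \<Rightarrow> real) \<times> ('s \<Rightarrow> ennreal) \<Rightarrow> bool"
  where "pair_le = (\<lambda>(f, g) (f', g'). \<forall>\<sigma>. g' \<sigma> \<noteq> \<infinity> \<longrightarrow> f \<sigma> \<le> f' \<sigma> \<and> g \<sigma> \<le> g' \<sigma>)"

definition pair_eq ::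
  "('s \<Rightarrow> real) \<times> ('s \<Rightarrow> ennreal) \<Rightarrow> ('s \<Rightarrow> real) \<times> ('s \<Rightarrow> ennreal) \<Rightarrow> bool"
  where "pair_eq a b \<longleftrightarrow> a \<in> witness_pairs \<and> b \<in> witness_pairs \<and> pair_le a b \<and> pair_le b a"

lemma pair_eq_iff:
  "pair_eq (f, g) (f', g') \<longleftrightarrow>
    (f, g) \<in> witness_pairs \<and> (f', g') \<in> witness_pairs \<and> g = g' \<and> (\<forall>\<sigma>. g \<sigma> \<noteq> \<infinity> \<longrightarrow> f \<sigma> = f' \<sigma>)"
proof -
  have "pair_le (f, g) (f', g') \<and> pair_le (f', g') (f, g) \<longleftrightarrow>
      g = g' \<and> (\<forall>\<sigma>. g \<sigma> \<noteq> \<infinity> \<longrightarrow> f \<sigma> = f' \<sigma>)"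
    unfolding pair_le_def fun_eq_iff case_prod_conv
    by (metis antisym infinity_ennreal_def neq_top_trans order_refl)
  then show ?thesis by (auto simp: pair_eq_def)
qed

quotient_type 's ie = "('s \<Rightarrow> real) \<times> ('s \<Rightarrow> ennreal)" / partial: pair_eq
  morphisms rep_ie abs_ie
proof (rule part_equivpI)
  show "\<exists>x :: ('s \<Rightarrow> real) \<times> ('s \<Rightarrow> ennreal). pair_eq x x"
    by (rule exI[of _ "(\<lambda>_. 0, \<lambda>_. 0)"]) (simp add: pair_eq_iff witness_pairs_def)
  show "symp (pair_eq :: ('s \<Rightarrow> real) \<times> ('s \<Rightarrow> ennreal) \<Rightarrow> _)"
    by (rule sympI) (auto simp: pair_eq_def)
  show "transp (pair_eq :: ('s \<Rightarrow> real) \<times> ('s \<Rightarrow> ennreal) \<Rightarrow> _)"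
    by (rule transpI) (auto simp: pair_eq_iff)
qed

text \<open>\<open>ie_class f g\<close> is the class of \<open>(f, g)\<close>; it is meaningful only for
  \<open>(f, g) \<in> witness_pairs\<close>.\<close>

definition ie_class :: "('s \<Rightarrow> real) \<Rightarrow> ('s \<Rightarrow> ennreal) \<Rightarrow> 's ie"
  where "ie_class f g = abs_ie (f, g)"

instantiation ie :: (type) order
begin

lift_definition less_eq_ie :: "'a ie \<Rightarrow> 'a ie \<Rightarrow> bool" is pair_le
  by (clarsimp simp: pair_eq_iff pair_le_def) (metis infinity_ennreal_def neq_top_trans)

definition less_ie :: "'a ie \<Rightarrow> 'a ie \<Rightarrow> bool"
  where "less_ie x y \<longleftrightarrow> x \<le> y \<and> \<not> y \<le> x"

instance
proof
  fix x y z :: "'a ie"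
  show "(x < y) = (x \<le> y \<and> \<not> y \<le> x)" by (rule less_ie_def)
  show "x \<le> x" by transfer (auto simp: pair_le_def)
  show "x \<le> y \<Longrightarrow> y \<le> z \<Longrightarrow> x \<le> z"
    by transfer (clarsimp simp: pair_le_def, metis infinity_ennreal_def neq_top_trans order_trans)
  show "x \<le> y \<Longrightarrow> y \<le> x \<Longrightarrow> x = y"
    by transfer (auto simp: pair_eq_def)
qed

end

instantiation ie :: (type) "{zero, plus}"
begin

lift_definition zero_ie :: "'a ie" is "(\<lambda>_. 0, \<lambda>_. 0)"
  by (simp add: pair_eq_iff witness_pairs_def)

lift_definition plus_ie :: "'a ie \<Rightarrow> 'a ie \<Rightarrow> 'a ie"
  is "\<lambda>(f, g) (f', g'). (\<lambda>\<sigma>. f \<sigma> + f' \<sigma>, \<lambda>\<sigma>. g \<sigma> + g' \<sigma>)"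
proof -
  have *: "ennreal \<bar>a + b\<bar> \<le> c + d" if "ennreal \<bar>a\<bar> \<le> c" "ennreal \<bar>b\<bar> \<le> d" for a b c d
  proof -
    have "ennreal \<bar>a + b\<bar> \<le> ennreal \<bar>a\<bar> + ennreal \<bar>b\<bar>"
      by (simp add: abs_triangle_ineq flip: ennreal_plus)
    also have "\<dots> \<le> c + d" using that by (rule add_mono)
    finally show ?thesis .
  qed
  fix a b c d :: "('a \<Rightarrow> real) \<times> ('a \<Rightarrow> ennreal)"
  assume "pair_eq a b" "pair_eq c d"
  then show "pair_eq ((\<lambda>(f, g) (f', g'). (\<lambda>\<sigma>. f \<sigma> + f' \<sigma>, \<lambda>\<sigma>. g \<sigma> + g' \<sigma>)) a c)
      ((\<lambda>(f, g) (f', g'). (\<lambda>\<sigma>. f \<sigma> + f' \<sigma>, \<lambda>\<sigma>. g \<sigma> + g' \<sigma>)) b d)"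
    by (cases a; cases b; cases c; cases d)
       (auto simp: pair_eq_iff witness_pairs_def intro!: *)
qed

instance ..

end

lift_definition ie_scale :: "('s \<Rightarrow> real) \<Rightarrow> 's ie \<Rightarrow> 's ie"
  is "\<lambda>c (f, g). (\<lambda>\<sigma>. c \<sigma> * f \<sigma>, \<lambda>\<sigma>. ennreal \<bar>c \<sigma>\<bar> * g \<sigma>)"
  by (auto simp: pair_eq_iff witness_pairs_def abs_mult ennreal_mult ennreal_mult_eq_top_iff
      intro!: mult_left_mono)

lift_definition ie_subst ::
  "('v, 'd) state ie \<Rightarrow> 'v \<Rightarrow> (('v, 'd) state \<Rightarrow> 'd) \<Rightarrow> ('v, 'd) state ie"
  is "\<lambda>(f, g) x E. (subst f x E, subst g x E)"
  by (auto simp: pair_eq_iff witness_pairs_def subst_def)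

text \<open>Pointwise convergence. The first components have to converge only where the limit of
  the second components is finite, as elsewhere they do not matter up to \<open>pair_eq\<close>.\<close>

lift_definition ie_tendsto :: "(nat \<Rightarrow> 's ie) \<Rightarrow> 's ie \<Rightarrow> bool"
  is "\<lambda>F (f, g). \<forall>\<sigma>. (\<lambda>n. snd (F n) \<sigma>) \<longlonglongrightarrow> g \<sigma> \<and>
        (g \<sigma> \<noteq> \<infinity> \<longrightarrow> (\<lambda>n. fst (F n) \<sigma>) \<longlonglongrightarrow> f \<sigma>)"
proof -
  have dir: "\<forall>\<sigma>. (\<lambda>n. snd (F' n) \<sigma>) \<longlonglongrightarrow> g' \<sigma> \<and> (g' \<sigma> \<noteq> \<infinity> \<longrightarrow> (\<lambda>n. fst (F' n) \<sigma>) \<longlonglongrightarrow> f' \<sigma>)"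
    if eq: "\<And>n. pair_eq (F n) (F' n)" "pair_eq (f, g) (f', g')"
      and lim: "\<forall>\<sigma>. (\<lambda>n. snd (F n) \<sigma>) \<longlonglongrightarrow> g \<sigma> \<and> (g \<sigma> \<noteq> \<infinity> \<longrightarrow> (\<lambda>n. fst (F n) \<sigma>) \<longlonglongrightarrow> f \<sigma>)"
    for F F' :: "nat \<Rightarrow> ('s \<Rightarrow> real) \<times> ('s \<Rightarrow> ennreal)" and f g f' g'
  proof (intro allI conjI impI)
    fix \<sigma>
    have snd_eq: "snd (F' n) = snd (F n)" for n
      using eq(1)[of n] by (cases "F n"; cases "F' n") (simp add: pair_eq_iff)
    have fst_eq: "fst (F' n) \<sigma> = fst (F n) \<sigma>" if "snd (F n) \<sigma> \<noteq> \<infinity>" for n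
      using eq(1)[of n] that by (cases "F n"; cases "F' n") (simp add: pair_eq_iff)
    have g: "g' = g" and f: "g \<sigma> \<noteq> \<infinity> \<Longrightarrow> f' \<sigma> = f \<sigma>" using eq(2) by (auto simp: pair_eq_iff)
    show "(\<lambda>n. snd (F' n) \<sigma>) \<longlonglongrightarrow> g' \<sigma>" using lim by (simp add: snd_eq g)
    assume fin: "g' \<sigma> \<noteq> \<infinity>"
    then have "(\<lambda>n. snd (F n) \<sigma>) \<longlonglongrightarrow> g \<sigma>" "g \<sigma> < \<infinity>"
      using lim by (auto simp: g less_top)
    then have "\<forall>\<^sub>F n in sequentially. snd (F n) \<sigma> < \<infinity>" by (rule order_tendstoD(2))
    then have "\<forall>\<^sub>F n in sequentially. fst (F n) \<sigma> = fst (F' n) \<sigma>"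
      by (rule eventually_mono) (simp add: fst_eq less_top)
    moreover have "(\<lambda>n. fst (F n) \<sigma>) \<longlonglongrightarrow> f' \<sigma>" using lim fin f by (simp add: g)
    ultimately show "(\<lambda>n. fst (F' n) \<sigma>) \<longlonglongrightarrow> f' \<sigma>" by (rule Lim_transform_eventually[rotated])
  qed
  have sym: "pair_eq a b \<Longrightarrow> pair_eq b a" for a b :: "('s \<Rightarrow> real) \<times> ('s \<Rightarrow> ennreal)"
    by (auto simp: pair_eq_def)
  fix F F' :: "nat \<Rightarrow> ('s \<Rightarrow> real) \<times> ('s \<Rightarrow> ennreal)"
    and a b :: "('s \<Rightarrow> real) \<times> ('s \<Rightarrow> ennreal)"
  assume F: "\<And>n. pair_eq (F n) (F' n)" and ab: "pair_eq a b"
  obtain f g f' g' where eq: "a = (f, g)" "b = (f', g')" by (cases a; cases b)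
  show "(case a of (f, g) \<Rightarrow> \<forall>\<sigma>. (\<lambda>n. snd (F n) \<sigma>) \<longlonglongrightarrow> g \<sigma> \<and>
        (g \<sigma> \<noteq> \<infinity> \<longrightarrow> (\<lambda>n. fst (F n) \<sigma>) \<longlonglongrightarrow> f \<sigma>)) =
      (case b of (f, g) \<Rightarrow> \<forall>\<sigma>. (\<lambda>n. snd (F' n) \<sigma>) \<longlonglongrightarrow> g \<sigma> \<and>
        (g \<sigma> \<noteq> \<infinity> \<longrightarrow> (\<lambda>n. fst (F' n) \<sigma>) \<longlonglongrightarrow> f \<sigma>))"
    unfolding eq case_prod_conv
    by (rule iffI, erule dir[OF F ab[unfolded eq]], erule dir[OF sym[OF F] sym[OF ab[unfolded eq]]])
qed

lemma ie_tendsto_unique: "ie_tendsto X L \<Longrightarrow> ie_tendsto X L' \<Longrightarrow> L = L'"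
proof transfer
  fix F :: "nat \<Rightarrow> ('s \<Rightarrow> real) \<times> ('s \<Rightarrow> ennreal)"
    and a b :: "('s \<Rightarrow> real) \<times> ('s \<Rightarrow> ennreal)"
  assume P: "pair_eq a a" "pair_eq b b"
    and A: "case a of (f, g) \<Rightarrow> \<forall>\<sigma>. (\<lambda>n. snd (F n) \<sigma>) \<longlonglongrightarrow> g \<sigma> \<and>
        (g \<sigma> \<noteq> \<infinity> \<longrightarrow> (\<lambda>n. fst (F n) \<sigma>) \<longlonglongrightarrow> f \<sigma>)"
    and B: "case b of (f, g) \<Rightarrow> \<forall>\<sigma>. (\<lambda>n. snd (F n) \<sigma>) \<longlonglongrightarrow> g \<sigma> \<and>
        (g \<sigma> \<noteq> \<infinity> \<longrightarrow> (\<lambda>n. fst (F n) \<sigma>) \<longlonglongrightarrow> f \<sigma>)"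
  obtain f g f' g' where ab: "a = (f, g)" "b = (f', g')" by (cases a; cases b)
  have g: "g \<sigma> = g' \<sigma>" for \<sigma>
  proof (rule LIMSEQ_unique)
    show "(\<lambda>n. snd (F n) \<sigma>) \<longlonglongrightarrow> g \<sigma>" using A by (simp add: ab)
    show "(\<lambda>n. snd (F n) \<sigma>) \<longlonglongrightarrow> g' \<sigma>" using B by (simp add: ab)
  qed
  moreover have "f \<sigma> = f' \<sigma>" if "g \<sigma> \<noteq> \<infinity>" for \<sigma>
  proof (rule LIMSEQ_unique)
    show "(\<lambda>n. fst (F n) \<sigma>) \<longlonglongrightarrow> f \<sigma>" using A that by (simp add: ab)
    show "(\<lambda>n. fst (F n) \<sigma>) \<longlonglongrightarrow> f' \<sigma>" using B that by (simp add: ab g)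
  qed
  ultimately show "pair_eq a b" using P by (simp add: ab pair_eq_iff fun_eq_iff)
qed

definition ie_lim :: "(nat \<Rightarrow> 's ie) \<Rightarrow> 's ie"
  where "ie_lim X = (THE L. ie_tendsto X L)"

definition ie_mix :: "('s \<Rightarrow> prob) \<Rightarrow> 's ie \<Rightarrow> 's ie \<Rightarrow> 's ie"
  where "ie_mix p x y =
    ie_scale (\<lambda>\<sigma>. real_of_prob (p \<sigma>)) x + ie_scale (\<lambda>\<sigma>. 1 - real_of_prob (p \<sigma>)) y"

definition ie_char_fun :: "('s \<Rightarrow> prob) \<Rightarrow> ('s ie \<Rightarrow> 's ie) \<Rightarrow> 's ie \<Rightarrow> 's ie \<Rightarrow> 's ie"
  where "ie_char_fun p T x X =
    ie_scale (\<lambda>\<sigma>. 1 - real_of_prob (p \<sigma>)) x + ie_scale (\<lambda>\<sigma>. real_of_prob (p \<sigma>)) (T X)"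

primrec wp_ie :: "('v, 'd) prog \<Rightarrow> ('v, 'd) state ie \<Rightarrow> ('v, 'd) state ie" where
  "wp_ie Skip x = x"
| "wp_ie (Assign v E) x = ie_subst x v E"
| "wp_ie (Seq C1 C2) x = wp_ie C1 (wp_ie C2 x)"
| "wp_ie (If p C1 C2) x = ie_mix p (wp_ie C1 x) (wp_ie C2 x)"
| "wp_ie (While p C) x = ie_lim (\<lambda>n. (ie_char_fun p (wp_ie C) x ^^ n) 0)"

text \<open>The defining condition of the order, with an arbitrary right-hand pair: a difference of
  two nonnegative expectations may be infinite or may exceed the intended witness in absolute
  value, and then it has no class.\<close>

lift_definition ie_le_pair :: "'s ie \<Rightarrow> ('s \<Rightarrow> ereal) \<Rightarrow> ('s \<Rightarrow> ennreal) \<Rightarrow> bool"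
  is "\<lambda>(f, g) h k. \<forall>\<sigma>. k \<sigma> \<noteq> \<infinity> \<longrightarrow> ereal (f \<sigma>) \<le> h \<sigma> \<and> g \<sigma> \<le> k \<sigma>"
  by (clarsimp simp: pair_eq_iff) (metis infinity_ennreal_def neq_top_trans)

lemma ie_le_pair_iff:
  assumes "(u, k) \<in> witness_pairs"
  shows "ie_le_pair x (\<lambda>\<sigma>. ereal (u \<sigma>)) k \<longleftrightarrow> x \<le> ie_class u k"
proof -
  have uk: "pair_eq (u, k) (u, k)" using assms by (simp add: pair_eq_iff)
  show ?thesis
  proof (induct x rule: ie.abs_induct)
    case (1 y)
    then show ?case unfolding ie_class_def ie_le_pair.abs_eq[OF 1] less_eq_ie.abs_eq[OF 1 uk]
      by (cases y) (simp only: pair_le_def case_prod_conv ereal_less_eq)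
  qed
qed

end

theory Submission imports Defs begin

text \<open>The class of \<open>(f, g)\<close> is the difference of \<open>f\<^sup>+ = max f 0\<close> and \<open>f\<^sup>- = max (- f) 0\<close>, both
  of which are bounded by \<open>g\<close>. As \<open>wp\<close> is monotone, the bound by the second component is
  preserved by every program, and hence the mixed-sign transformer maps \<open>f\<^sup>+ - f\<^sup>-\<close> to
  \<open>wp f\<^sup>+ - wp f\<^sup>-\<close> wherever \<open>wp g\<close> is finite. By additivity of \<open>wp\<close> this is
  \<open>wp (\<bar>f\<bar> + f) - wp \<bar>f\<bar>\<close>. Park induction bounds the first term from above by \<open>I\<close> and
  \<open>wp g\<close> by \<open>G\<close>, and \<open>H n\<close> is below the iterates of the characteristic functional of \<open>\<bar>f\<bar>\<close>.\<close>

section \<open>Probabilities and passage from extended to real values\<close>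

lemma real_of_prob_bounds: "0 \<le> real_of_prob q" "real_of_prob q \<le> 1"
  using real_of_prob[of q] by auto

lemma enn2real_add:
  assumes "a \<noteq> top" "b \<noteq> top"
  shows "enn2real (a + b) = enn2real a + enn2real b"
  using assms by (cases a; cases b) (auto simp flip: ennreal_plus)

text \<open>A difference of two nonnegative reals is at most the larger one in absolute value. Since
  \<open>enn2real\<close> sends \<open>top\<close> to 0, \<open>ennreal (enn2real x) \<le> x\<close>
  holds for infinite \<open>x\<close> too.\<close>

lemma abs_enn2real_diff_le:
  assumes "a \<le> c" "b \<le> c"
  shows "ennreal \<bar>enn2real a - enn2real b\<bar> \<le> c"
proof -
  have le: "ennreal r \<le> c" if "r \<le> enn2real x" "x \<le> c" for r x
  proof -
    have "ennreal r \<le> ennreal (enn2real x)" using that(1) by (rule ennreal_leI)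
    also have "\<dots> \<le> x" by (cases x) simp_all
    finally show ?thesis using that(2) by (rule order_trans)
  qed
  have "\<bar>enn2real a - enn2real b\<bar> \<le> enn2real a \<or> \<bar>enn2real a - enn2real b\<bar> \<le> enn2real b"
    using enn2real_nonneg[of a] enn2real_nonneg[of b] by linarith
  then show ?thesis
    using le assms by blast
qed

section \<open>Continuity and additivity of the standard transformer\<close>

text \<open>Continuity in the postexpectation, with the argument varying along with it through
  \<open>k\<close>; this is the form from which continuity of a least fixed point in its parameter
  follows.\<close>

lemma sup_continuous_char_fun_iterate:
  assumes "sup_continuous T" "sup_continuous k"
  shows "sup_continuous (\<lambda>h. char_fun p T h (k h))"
  unfolding char_fun_def
  by (intro sup_continuous_fun sup_continuous_add_ennreal sup_continuous_mult_left_ennreal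
      sup_continuous_apply sup_continuous_applyD[OF sup_continuous_compose[OF assms]])

lemma sup_continuous_char_fun:
  assumes "sup_continuous T"
  shows "sup_continuous (char_fun p T h)"
  unfolding char_fun_def
  by (intro sup_continuous_fun sup_continuous_add_ennreal sup_continuous_mult_left_ennreal
      sup_continuous_const sup_continuous_applyD[OF assms])

lemma char_fun_mono:
  assumes "mono T" "h \<le> h'" "X \<le> X'"
  shows "char_fun p T h X \<le> char_fun p T h' X'"
  using assms(2) monoD[OF assms(1,3)]
  by (auto simp: char_fun_def le_fun_def intro!: add_mono mult_left_mono)

lemma char_fun_add:
  assumes "\<And>X Y. T (\<lambda>\<sigma>. X \<sigma> + Y \<sigma>) = (\<lambda>\<sigma>. T X \<sigma> + T Y \<sigma>)"
  shows "char_fun p T (\<lambda>\<sigma>. h \<sigma> + k \<sigma>) (\<lambda>\<sigma>. X \<sigma> + Y \<sigma>)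
    = (\<lambda>\<sigma>. char_fun p T h X \<sigma> + char_fun p T k Y \<sigma>)"
  by (simp add: char_fun_def assms algebra_simps)

text \<open>Kleene iteration from \<open>bot\<close>, read pointwise. Both facts together make the
  fixed point the limit of its iterates.\<close>

lemma lfp_char_fun:
  assumes "sup_continuous T"
  shows "lfp (char_fun p T h) \<sigma> = (SUP n. (char_fun p T h ^^ n) bot \<sigma>)"
    and "incseq (\<lambda>n. (char_fun p T h ^^ n) bot \<sigma>)"
  using mono_funpow[OF sup_continuous_mono[OF sup_continuous_char_fun[OF assms]], of p h]
  by (simp_all add: sup_continuous_lfp[OF sup_continuous_char_fun[OF assms]] image_comp
      incseq_def le_fun_def)

lemma sup_continuous_wp: "sup_continuous (wp C)"
proof (induction C)
  case (Assign x E)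
  show ?case unfolding wp.simps subst_def
    by (intro sup_continuous_fun sup_continuous_apply)
next
  case (Seq C1 C2)
  then show ?case using sup_continuous_compose by auto
next
  case (If p C1 C2)
  show ?case unfolding wp.simps mix_def
    by (intro sup_continuous_fun sup_continuous_add_ennreal sup_continuous_mult_left_ennreal
        sup_continuous_applyD[OF If.IH(1)] sup_continuous_applyD[OF If.IH(2)])
next
  case (While p C)
  show ?case unfolding wp.simps
    by (intro sup_continuous_lfp'' sup_continuous_char_fun[OF While.IH]
        sup_continuous_char_fun_iterate[OF While.IH])
qed (simp_all add: sup_continuous_id)

lemmas mono_wp = sup_continuous_mono[OF sup_continuous_wp]

text \<open>For a loop, additivity holds for each iterate, as \<open>char_fun\<close> is additive
  jointly in postexpectation and argument. It passes to the fixed point because suprema of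
  increasing sequences commute with sums.\<close>

lemma wp_add: "wp C (\<lambda>\<sigma>. a \<sigma> + b \<sigma>) = (\<lambda>\<sigma>. wp C a \<sigma> + wp C b \<sigma>)"
proof (induction C arbitrary: a b)
  case (While p C)
  have iter: "(char_fun p (wp C) (\<lambda>\<sigma>. a \<sigma> + b \<sigma>) ^^ n) bot
      = (\<lambda>\<sigma>. (char_fun p (wp C) a ^^ n) bot \<sigma> + (char_fun p (wp C) b ^^ n) bot \<sigma>)" for n
  proof (induction n)
    case (Suc n)
    then show ?case by (simp add: char_fun_add[where T = "wp C", OF While])
  qed (simp add: bot_ennreal fun_eq_iff)
  show ?case
    by (simp add: fun_eq_iff lfp_char_fun[OF sup_continuous_wp] iter ennreal_SUP_add)
qed (simp_all add: subst_def mix_def algebra_simps)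

section \<open>Classes as differences of nonnegative expectations\<close>

text \<open>Intended for \<open>a \<le> g\<close> and \<open>b \<le> g\<close>: a value
  \<open>top\<close> of \<open>a\<close> or \<open>b\<close>, which \<open>enn2real\<close> turns
  into 0, then occurs only where \<open>g\<close> is infinite and the first component is
  irrelevant.\<close>

definition ie_diff :: "('s \<Rightarrow> ennreal) \<Rightarrow> ('s \<Rightarrow> ennreal) \<Rightarrow> ('s \<Rightarrow> ennreal) \<Rightarrow> 's ie"
  where "ie_diff a b g = ie_class (\<lambda>\<sigma>. enn2real (a \<sigma>) - enn2real (b \<sigma>)) g"

lemma ie_class_eqI:
  assumes "(f, g) \<in> witness_pairs" "(f', g) \<in> witness_pairs" "\<And>\<sigma>. g \<sigma> \<noteq> top \<Longrightarrow> f \<sigma> = f' \<sigma>"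
  shows "ie_class f g = ie_class f' g"
  unfolding ie_class_def by (rule Quotient_rel_abs[OF Quotient_ie]) (use assms in \<open>simp add: pair_eq_iff\<close>)

lemma ie_diff_witness:
  assumes "a \<le> g" "b \<le> g"
  shows "(\<lambda>\<sigma>. enn2real (a \<sigma>) - enn2real (b \<sigma>), g) \<in> witness_pairs"
  using assms by (simp add: witness_pairs_def le_fun_def abs_enn2real_diff_le)

lemma pair_eq_refl: "x \<in> witness_pairs \<Longrightarrow> pair_eq x x"
  by (cases x) (simp add: pair_eq_iff)

text \<open>\<open>ennreal\<close> cuts negative reals to 0, so the two arguments are the positive
  and the negative part of \<open>f\<close>.\<close>

lemma ie_class_eq_diff:
  "ie_class f g = ie_diff (\<lambda>\<sigma>. ennreal (f \<sigma>)) (\<lambda>\<sigma>. ennreal (- f \<sigma>)) g"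
proof -
  have "enn2real (ennreal r) - enn2real (ennreal (- r)) = r" for r
    by (cases "0 \<le> r") (simp_all add: ennreal_neg)
  then show ?thesis by (simp add: ie_diff_def)
qed

lemma ie_zero_eq_diff: "0 = ie_diff bot bot (bot :: 's \<Rightarrow> ennreal)"
  by (simp add: ie_diff_def ie_class_def zero_ie.abs_eq bot_ennreal bot_fun_def)

lemma ie_subst_diff:
  assumes "a \<le> g" "b \<le> g"
  shows "ie_subst (ie_diff a b g) v E = ie_diff (subst a v E) (subst b v E) (subst g v E)"
  by (simp add: ie_diff_def ie_class_def ie_subst.abs_eq[OF pair_eq_refl[OF ie_diff_witness[OF assms]]])
    (simp add: subst_def)

text \<open>The representatives may differ where a summand is \<open>top\<close>, since
  \<open>enn2real\<close> is not additive there. The bounds make \<open>g + g'\<close> infinite at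
  such states, so the classes agree.\<close>

lemma ie_plus_diff:
  assumes "a \<le> g" "b \<le> g" "a' \<le> g'" "b' \<le> g'"
  shows "ie_diff a b g + ie_diff a' b' g' =
    ie_diff (\<lambda>\<sigma>. a \<sigma> + a' \<sigma>) (\<lambda>\<sigma>. b \<sigma> + b' \<sigma>) (\<lambda>\<sigma>. g \<sigma> + g' \<sigma>)"
proof -
  note w = ie_diff_witness[OF assms(1,2)] ie_diff_witness[OF assms(3,4)]
  have "ie_diff a b g + ie_diff a' b' g' = ie_class
      (\<lambda>\<sigma>. enn2real (a \<sigma>) - enn2real (b \<sigma>) + (enn2real (a' \<sigma>) - enn2real (b' \<sigma>))) (\<lambda>\<sigma>. g \<sigma> + g' \<sigma>)"
    by (simp add: ie_diff_def ie_class_def plus_ie.abs_eq[OF pair_eq_refl[OF w(1)] pair_eq_refl[OF w(2)]])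
  also have "\<dots> = ie_diff (\<lambda>\<sigma>. a \<sigma> + a' \<sigma>) (\<lambda>\<sigma>. b \<sigma> + b' \<sigma>) (\<lambda>\<sigma>. g \<sigma> + g' \<sigma>)"
    unfolding ie_diff_def
  proof (rule ie_class_eqI)
    show "(\<lambda>\<sigma>. enn2real (a \<sigma>) - enn2real (b \<sigma>) + (enn2real (a' \<sigma>) - enn2real (b' \<sigma>)), \<lambda>\<sigma>. g \<sigma> + g' \<sigma>)
        \<in> witness_pairs"
      using w by (auto simp: witness_pairs_def
          intro!: order_trans[OF ennreal_leI[OF abs_triangle_ineq]] add_mono)
    show "(\<lambda>\<sigma>. enn2real (a \<sigma> + a' \<sigma>) - enn2real (b \<sigma> + b' \<sigma>), \<lambda>\<sigma>. g \<sigma> + g' \<sigma>) \<in> witness_pairs"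
      using assms by (intro ie_diff_witness) (auto simp: le_fun_def add_mono)
    fix \<sigma> assume "g \<sigma> + g' \<sigma> \<noteq> top"
    then have "a \<sigma> \<noteq> top" "b \<sigma> \<noteq> top" "a' \<sigma> \<noteq> top" "b' \<sigma> \<noteq> top"
      using assms by (auto simp: le_fun_def top_unique dest: spec[of _ \<sigma>])
    then show "enn2real (a \<sigma>) - enn2real (b \<sigma>) + (enn2real (a' \<sigma>) - enn2real (b' \<sigma>))
        = enn2real (a \<sigma> + a' \<sigma>) - enn2real (b \<sigma> + b' \<sigma>)"
      by (simp add: enn2real_add)
  qed
  finally show ?thesis .
qed

text \<open>Unlike for sums, the representatives coincide: \<open>enn2real\<close> is multiplicative
  even at \<open>top\<close>.\<close>

lemma ie_scale_diff:
  assumes "a \<le> g" "b \<le> g" "\<And>\<sigma>. 0 \<le> c \<sigma>"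
  shows "ie_scale c (ie_diff a b g) =
    ie_diff (\<lambda>\<sigma>. ennreal (c \<sigma>) * a \<sigma>) (\<lambda>\<sigma>. ennreal (c \<sigma>) * b \<sigma>) (\<lambda>\<sigma>. ennreal (c \<sigma>) * g \<sigma>)"
  by (simp add: ie_diff_def ie_class_def ie_scale.abs_eq[OF pair_eq_refl[OF ie_diff_witness[OF assms(1,2)]]]
      enn2real_mult assms(3) right_diff_distrib)

section \<open>Limits of classes\<close>

lemma ie_lim_eqI: "ie_tendsto X L \<Longrightarrow> ie_lim X = L"
  unfolding ie_lim_def using ie_tendsto_unique by blast

lemma ie_tendsto_classI:
  assumes "\<And>n. (u n, v n) \<in> witness_pairs" "(f, g) \<in> witness_pairs"
    and "\<And>\<sigma>. (\<lambda>n. v n \<sigma>) \<longlonglongrightarrow> g \<sigma>"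
    and "\<And>\<sigma>. g \<sigma> \<noteq> top \<Longrightarrow> (\<lambda>n. u n \<sigma>) \<longlonglongrightarrow> f \<sigma>"
  shows "ie_tendsto (\<lambda>n. ie_class (u n) (v n)) (ie_class f g)"
proof -
  \<comment> \<open>The lifted predicate takes a sequence of classes, so its abstraction equation
    asks for relatedness of the sequence as a function of \<open>n\<close>.\<close>
  have "rel_fun (=) pair_eq (\<lambda>n. (u n, v n)) (\<lambda>n. (u n, v n))"
    using assms(1) by (auto simp: rel_fun_def pair_eq_refl)
  from ie_tendsto.abs_eq[OF this pair_eq_refl[OF assms(2)]] show ?thesis
    using assms(3,4) by (simp add: ie_class_def comp_def)
qed

text \<open>\<open>enn2real\<close> is continuous at finite values only. Where \<open>g\<close> is
  finite so are \<open>a\<close> and \<open>b\<close>; elsewhere the first components need not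
  converge.\<close>

lemma ie_tendsto_diff:
  assumes "\<And>n. A n \<le> G n" "\<And>n. B n \<le> G n"
    and "a \<le> g" "b \<le> g"
    and "\<And>\<sigma>. (\<lambda>n. A n \<sigma>) \<longlonglongrightarrow> a \<sigma>" "\<And>\<sigma>. (\<lambda>n. B n \<sigma>) \<longlonglongrightarrow> b \<sigma>" "\<And>\<sigma>. (\<lambda>n. G n \<sigma>) \<longlonglongrightarrow> g \<sigma>"
  shows "ie_tendsto (\<lambda>n. ie_diff (A n) (B n) (G n)) (ie_diff a b g)"
  unfolding ie_diff_def
proof (rule ie_tendsto_classI)
  fix \<sigma> assume "g \<sigma> \<noteq> top"
  then have fin: "a \<sigma> < top" "b \<sigma> < top"
    using assms(3,4) by (auto simp: le_fun_def less_top top_unique dest: spec[of _ \<sigma>])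
  show "(\<lambda>n. enn2real (A n \<sigma>) - enn2real (B n \<sigma>)) \<longlonglongrightarrow> enn2real (a \<sigma>) - enn2real (b \<sigma>)"
    using assms(5,6)[of \<sigma>] fin by (intro tendsto_diff tendsto_enn2real) simp_all
qed (use assms in \<open>auto intro: ie_diff_witness\<close>)

section \<open>The mixed-sign transformer on differences\<close>

text \<open>One loop iteration, with \<open>T\<close> and \<open>S\<close> standing for the standard
  and the mixed-sign transformer of the body. Monotonicity of \<open>T\<close> keeps the bound by
  the third component.\<close>

lemma ie_char_fun_diff:
  assumes "mono T" "\<And>a b g. a \<le> g \<Longrightarrow> b \<le> g \<Longrightarrow> S (ie_diff a b g) = ie_diff (T a) (T b) (T g)"
    and "a \<le> g" "b \<le> g" "X \<le> Z" "Y \<le> Z"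
  shows "ie_char_fun p S (ie_diff a b g) (ie_diff X Y Z)
    = ie_diff (char_fun p T a X) (char_fun p T b Y) (char_fun p T g Z)"
proof -
  have "T X \<le> T Z" "T Y \<le> T Z"
    using assms(1,5,6) by (auto dest: monoD)
  then show ?thesis
    unfolding ie_char_fun_def char_fun_def assms(2)[OF assms(5,6)]
    using assms(3,4)
    by (subst (1 2) ie_scale_diff)
      (auto simp: real_of_prob_bounds le_fun_def mult_left_mono intro!: ie_plus_diff)
qed

text \<open>The mixed-sign transformer acts on the positive part, the negative part and the bound
  separately. The induction covers all \<open>a\<close>, \<open>b\<close>, \<open>g\<close>, because
  a loop body is applied to the iterates.\<close>

lemma wp_ie_diff: "a \<le> g \<Longrightarrow> b \<le> g \<Longrightarrow> wp_ie C (ie_diff a b g) = ie_diff (wp C a) (wp C b) (wp C g)"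
proof (induction C arbitrary: a b g)
  case (Assign x E)
  then show ?case by (simp add: ie_subst_diff)
next
  case (Seq C1 C2)
  then show ?case by (simp add: monoD[OF mono_wp])
next
  case (If p C1 C2)
  have "wp C1 a \<le> wp C1 g" "wp C1 b \<le> wp C1 g" "wp C2 a \<le> wp C2 g" "wp C2 b \<le> wp C2 g"
    using If.prems by (auto intro: monoD[OF mono_wp])
  then show ?case
    using If.prems unfolding wp_ie.simps wp.simps ie_mix_def mix_def If.IH(1)[OF If.prems] If.IH(2)[OF If.prems]
    by (subst (1 2) ie_scale_diff)
      (auto simp: real_of_prob_bounds le_fun_def mult_left_mono intro!: ie_plus_diff)
next
  case (While p C)
  let ?\<Phi> = "\<lambda>h. char_fun p (wp C) h"
  \<comment> \<open>Keeps the iterates of \<open>a\<close> and \<open>b\<close> below those of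
    \<open>g\<close>, so that each of them is again a proper difference.\<close>
  have le: "(?\<Phi> h ^^ n) bot \<le> (?\<Phi> h' ^^ n) bot" if "h \<le> h'" for h h' n
    using that by (induction n) (simp_all add: char_fun_mono mono_wp)
  have "(ie_char_fun p (wp_ie C) (ie_diff a b g) ^^ n) 0
      = ie_diff ((?\<Phi> a ^^ n) bot) ((?\<Phi> b ^^ n) bot) ((?\<Phi> g ^^ n) bot)" for n
  proof (induction n)
    case 0
    then show ?case by (simp only: funpow_0 ie_zero_eq_diff)
  next
    case (Suc n)
    then show ?case
      by (simp only: funpow.simps comp_apply ie_char_fun_diff[OF mono_wp While.IH While.prems le le]
          While.prems)
  qed
  moreover have "(\<lambda>n. (?\<Phi> h ^^ n) bot \<sigma>) \<longlonglongrightarrow> lfp (?\<Phi> h) \<sigma>" for h \<sigma>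
    using LIMSEQ_SUP[OF lfp_char_fun(2)[OF sup_continuous_wp]]
    by (simp add: lfp_char_fun(1)[OF sup_continuous_wp])
  moreover have "lfp (?\<Phi> h) \<le> lfp (?\<Phi> h')" if "h \<le> h'" for h h'
    using that by (intro lfp_mono char_fun_mono mono_wp order_refl)
  ultimately show ?case
    using While.prems by (simp add: ie_lim_eqI ie_tendsto_diff le)
qed simp

section \<open>The upper bound for loops\<close>

lemma ie_le_pair_diff:
  assumes "a \<le> g" "b \<le> g"
  shows "ie_le_pair (ie_diff a b g) h k \<longleftrightarrow>
    (\<forall>\<sigma>. k \<sigma> \<noteq> \<infinity> \<longrightarrow> ereal (enn2real (a \<sigma>) - enn2real (b \<sigma>)) \<le> h \<sigma> \<and> g \<sigma> \<le> k \<sigma>)"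
  by (simp add: ie_diff_def ie_class_def ie_le_pair.abs_eq[OF pair_eq_refl[OF ie_diff_witness[OF assms]]])

text \<open>Write \<open>a - b\<close> as \<open>(a + a) - (a + b)\<close>. Finiteness of
  \<open>a\<close> and \<open>b\<close> forces \<open>d\<close> to be finite, so for
  \<open>c = top\<close> the right-hand side is infinite and the claim is trivial.\<close>

lemma diff_le_of_double_le:
  assumes "a + a \<le> c" "d \<le> a + b" "a \<noteq> top" "b \<noteq> top"
  shows "ereal (enn2real a - enn2real b) \<le> enn2ereal c - enn2ereal d"
proof -
  obtain p q where pq: "a = ennreal p" "0 \<le> p" "b = ennreal q" "0 \<le> q"
    using assms(3,4) by (cases a; cases b) auto
  have "d \<le> ennreal (p + q)" using assms(2) pq by simp
  then obtain s where s: "d = ennreal s" "0 \<le> s" "s \<le> p + q"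
    using pq by (cases d) (auto simp: top_unique simp del: ennreal_plus)
  show ?thesis
  proof (cases c)
    case (real r)
    then have "p + p \<le> r" using assms(1) pq by (simp flip: ennreal_plus)
    then show ?thesis using real pq s by simp
  qed (use pq s in simp)
qed

theorem theorem5:
  fixes f :: "('v, 'd) state \<Rightarrow> real" and g :: "('v, 'd) state \<Rightarrow> ennreal"
    and C' :: "('v, 'd) prog" and \<xi> :: "('v, 'd) guard"
    and I G :: "('v, 'd) state \<Rightarrow> ennreal" and H :: "nat \<Rightarrow> ('v, 'd) state \<Rightarrow> ennreal"
  assumes "(f, g) \<in> witness_pairs"
    and "\<And>\<sigma>. G \<sigma> < \<infinity>"
    and "char_fun \<xi> (wp C') g G \<le> G"
    and "char_fun \<xi> (wp C') (\<lambda>\<sigma>. ennreal (\<bar>f \<sigma>\<bar> + f \<sigma>)) I \<le> I"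
    and "H 0 \<le> char_fun \<xi> (wp C') (\<lambda>\<sigma>. ennreal \<bar>f \<sigma>\<bar>) (\<lambda>_. 0)"
    and "\<And>n. H (Suc n) \<le> char_fun \<xi> (wp C') (\<lambda>\<sigma>. ennreal \<bar>f \<sigma>\<bar>) (H n)"
  shows "ie_le_pair (wp_ie (While \<xi> C') (ie_class f g))
           (\<lambda>\<sigma>. enn2ereal (I \<sigma>) - enn2ereal (SUP n. H n \<sigma>)) (\<lambda>\<sigma>. 2 * G \<sigma>)
       \<and> (\<forall>u. (\<forall>\<sigma>. ereal (u \<sigma>) = enn2ereal (I \<sigma>) - enn2ereal (SUP n. H n \<sigma>)) \<and>
              (u, \<lambda>\<sigma>. 2 * G \<sigma>) \<in> witness_pairs \<longrightarrow>
            wp_ie (While \<xi> C') (ie_class f g) \<le> ie_class u (\<lambda>\<sigma>. 2 * G \<sigma>))"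
proof -
  let ?\<Phi> = "\<lambda>h. char_fun \<xi> (wp C') h" and ?W = "wp (While \<xi> C')"
  let ?a = "\<lambda>\<sigma>. ennreal (f \<sigma>)" and ?b = "\<lambda>\<sigma>. ennreal (- f \<sigma>)"
  \<comment> \<open>These identities turn the expectations of the hypotheses into sums of the
    positive and negative parts, to which \<open>wp_add\<close> applies.\<close>
  have pos: "ennreal (\<bar>r\<bar> + r) = ennreal r + ennreal r"
    and abs: "ennreal \<bar>r\<bar> = ennreal r + ennreal (- r)" for r
  proof -
    show "ennreal (\<bar>r\<bar> + r) = ennreal r + ennreal r"
      by (cases "0 \<le> r") (simp_all add: ennreal_neg flip: ennreal_plus)
    show "ennreal \<bar>r\<bar> = ennreal r + ennreal (- r)"
      by (cases "0 \<le> r") (simp_all add: ennreal_neg)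
  qed
  have "ennreal r \<le> g \<sigma>" if "r \<le> \<bar>f \<sigma>\<bar>" for r \<sigma>
    using order_trans[OF ennreal_leI[OF that]] assms(1) by (simp add: witness_pairs_def)
  then have ab: "?a \<le> g" "?b \<le> g"
    by (simp_all add: le_fun_def)
  have Wab: "?W ?a \<le> ?W g" "?W ?b \<le> ?W g"
    by (intro monoD[OF mono_wp] ab)+
  have G: "?W g \<le> G"
    unfolding wp.simps using assms(3) by (rule lfp_lowerbound)
  have "?W (\<lambda>\<sigma>. ennreal (\<bar>f \<sigma>\<bar> + f \<sigma>)) \<le> I"
    unfolding wp.simps using assms(4) by (rule lfp_lowerbound)
  then have I: "?W ?a \<sigma> + ?W ?a \<sigma> \<le> I \<sigma>" for \<sigma>
    unfolding pos wp_add by (rule le_funD)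
  have mono: "mono (?\<Phi> h)" for h
    by (intro sup_continuous_mono sup_continuous_char_fun sup_continuous_wp)
  \<comment> \<open>Each \<open>H n\<close> is compared with the fixed point itself: applying
    \<open>?\<Phi>\<close> to anything below it stays below it, and the base case starts from
    0.\<close>
  have "H n \<le> ?W (\<lambda>\<sigma>. ennreal \<bar>f \<sigma>\<bar>)" for n
    unfolding wp.simps
  proof (induction n)
    case 0
    have "?\<Phi> (\<lambda>\<sigma>. ennreal \<bar>f \<sigma>\<bar>) (\<lambda>_. 0) \<le> lfp (?\<Phi> (\<lambda>\<sigma>. ennreal \<bar>f \<sigma>\<bar>))"
      by (rule order_trans[OF monoD[OF mono] eq_refl[OF lfp_unfold[OF mono, symmetric]]])
        (simp add: le_fun_def)
    with assms(5) show ?case by (rule order_trans)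
  next
    case (Suc n)
    then show ?case
      using order_trans[OF assms(6) monoD[OF mono Suc]] by (simp only: flip: lfp_unfold[OF mono])
  qed
  then have "H n \<sigma> \<le> ?W ?a \<sigma> + ?W ?b \<sigma>" for n \<sigma>
    unfolding abs wp_add by (rule le_funD)
  then have H: "(SUP n. H n \<sigma>) \<le> ?W ?a \<sigma> + ?W ?b \<sigma>" for \<sigma>
    by (rule SUP_least)
  \<comment> \<open>Both parts lie below \<open>?W g\<close>, hence below the finite
    \<open>G\<close>.\<close>
  have fin: "?W ?a \<sigma> \<noteq> top" "?W ?b \<sigma> \<noteq> top" for \<sigma>
    using assms(2)[of \<sigma>] le_funD[OF order_trans[OF Wab(1) G], of \<sigma>]
      le_funD[OF order_trans[OF Wab(2) G], of \<sigma>]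
    by (auto simp only: top_unique less_irrefl infinity_ennreal_def)
  have le2: "?W g \<sigma> \<le> 2 * G \<sigma>" for \<sigma>
  proof -
    have "?W g \<sigma> \<le> G \<sigma>" using G by (rule le_funD)
    also have "\<dots> \<le> 2 * G \<sigma>" by (simp add: mult_2)
    finally show ?thesis .
  qed
  have main: "ie_le_pair (wp_ie (While \<xi> C') (ie_class f g))
      (\<lambda>\<sigma>. enn2ereal (I \<sigma>) - enn2ereal (SUP n. H n \<sigma>)) (\<lambda>\<sigma>. 2 * G \<sigma>)"
    unfolding ie_class_eq_diff wp_ie_diff[OF ab] ie_le_pair_diff[OF Wab]
    by (intro allI impI conjI diff_le_of_double_le I H fin le2)
  \<comment> \<open>If the difference is real-valued and dominated by \<open>2 * G\<close>, it has a
    class, and the inequality for pairs is the order on classes.\<close>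
  moreover have "wp_ie (While \<xi> C') (ie_class f g) \<le> ie_class u (\<lambda>\<sigma>. 2 * G \<sigma>)"
    if "\<forall>\<sigma>. ereal (u \<sigma>) = enn2ereal (I \<sigma>) - enn2ereal (SUP n. H n \<sigma>)"
      "(u, \<lambda>\<sigma>. 2 * G \<sigma>) \<in> witness_pairs" for u
  proof -
    have "(\<lambda>\<sigma>. ereal (u \<sigma>)) = (\<lambda>\<sigma>. enn2ereal (I \<sigma>) - enn2ereal (SUP n. H n \<sigma>))"
      using that(1) by simp
    with main show ?thesis by (simp only: flip: ie_le_pair_iff[OF that(2)])
  qed
  ultimately show ?thesis by blast
qed

end
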